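(* Let $Q=(St_Q, Q_1\parallel\cdots\parallel Q_K)$ be any finite-state shared memory concurrent program. Then there exists a finite-state shared memory concurrent program $PP=(St_{PP}, PP_1\parallel\cdots\parallel PP_K)$ such that (1) the global state transition diagrams of $Q$ and $PP$ are strongly bisimilar, and (2) $PP$ is in pairwise normal form.
   Context: Model of computation. A concurrent program is $P=(St, P_1\parallel\cdots\parallel P_K)$ where $St$ is a set of initial global states and each process $P_i$ is a synchronization skeleton: a finite directed multigraph whose nodes are local states of $P_i$ and whose arcs $(s_i, B_i\to A_i, s_i')$ are labeled by a guarded command (guard $B_i$, a predicate on global states; action $A_i$, terminating straight-line code updating shared variables); every node has an outgoing arc and there are no self-loops. Each $P_i$ has a set $AP_i$ of atomic propositions (pairwise disjoint across processes, written only by $P_i$ and readable by all) and a labeling $V_i$ of local states by subsets of $AP_i$, with distinct local states having distinct labels. There is a finite set $\mathcal{SH}$ of finite-valued shared variables. A global state is a tuple $(s_1,\dots,s_K,v_1,\dots,v_m)$ of local states and values of the shared variables. If $P_i$ has an arc $(s_i,B_i\to A_i,s_i')$, the current global state $s$ has $P_i$ in $s_i$ and $s\models B_i$, then $(s,i,s')$ is a transition, where $s'$ has $P_i$ in $s_i'$ and shared variables updated by $A_i$ (interleaving semantics). The global state transition diagram (GSTD) of $P$ is the Kripke structure $M=(St,S,R)$ where $S$ is the set of global states reachable from $St$ and $R\subseteq S\times[K]\times S$ is the transition relation restricted to $S$. Strong bisimulation. For Kripke structures $M=(St,S,R)$, $M'=(St',S',R')$ over the same atomic propositions $AP$, a relation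 $B\subseteq S\times S'$ is a strong bisimulation if whenever $B(s,s')$: $s$ and $s'$ make the same atomic propositions true; if $(s,i,u)\in R$ then there is $u'$ with $(s',i,u')\in R'$ and $B(u,u')$; and if $(s',i,u')\in R'$ then there is $u$ with $(s,i,u)\in R$ and $B(u,u')$. $M$ and $M'$ are strongly bisimilar if some strong bisimulation relates every initial state of $M$ to some initial state of $M'$ and vice versa. Pairwise normal form. A program $P_1\parallel\cdots\parallel P_K$ is in pairwise normal form with respect to an irreflexive symmetric relation $I$ on $[K]$ (with $I(i)=\{j:(i,j)\in I\}$) if: (1) every arc of every $P_i$ has the form $(s_i, \otimes_{j\in I(i)}\oplus_{\ell\in\{1,\dots,n_j\}} B^{i}_{j,\ell}\to A^{i}_{j,\ell}, t_i)$, where $\oplus$ means exactly one of the alternatives is executed and $\otimes$ means all the components are executed simultaneously (all chosen guards must hold, and the chosen actions are executed together as one parallel assignment); (2) for each $(i,j)\in I$ there is a set $\mathcal{SH}_{ij}$ of shared variables which are the only variables read and written by both $P_i$ and $P_j$; (3) each guard $B^i_{j,\ell}$ references only variables in $\mathcal{SH}_{ij}$ and atomic propositions in $AP_j$; (4) each action $A^i_{j,\ell}$ updates only variables in $\mathcal{SH}_{ij}$.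
   Formalization: The formal theorem assumes K ≥ 2; for K = 1 the claim fails, since I is empty, so arcs of PP_1 carry no guard or action and PP_1, whose local states have distinct labels, has no memory to mimic Q's shared variables. *)

theory Defs
  imports Main "HOL-Library.FuncSet"
begin

section \<open>Guarded commands\<close>

text \<open>Processes are numbered from 1. Components of a global state at indices that are not
  processes, or at names that are not shared variables, carry no information; they are fixed to
  \<^term>\<open>undefined\<close> by \<open>global_states\<close> below.\<close>

record ('l, 'x, 'v) gstate =
  loc :: "nat \<Rightarrow> 'l"
  sh :: "'x \<Rightarrow> 'v"

text \<open>Straight-line code: a list of assignments \<open>x := e\<close>, executed from left to right.
  Expressions, like guards, are represented by their denotation.\<close>

type_synonym ('l, 'x, 'v) action = "('x \<times> (('l, 'x, 'v) gstate \<Rightarrow> 'v)) list"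

fun exec :: "('l, 'x, 'v) action \<Rightarrow> ('l, 'x, 'v) gstate \<Rightarrow> ('l, 'x, 'v) gstate" where
  "exec [] g = g"
| "exec ((x, e) # A) g = exec A (g\<lparr>sh := (sh g)(x := e g)\<rparr>)"

definition updates :: "('l, 'x, 'v) action \<Rightarrow> ('l, 'x, 'v) gstate \<Rightarrow> 'x \<rightharpoonup> 'v" where
  "updates A g = (\<lambda>x. if x \<in> fst ` set A then Some (sh (exec A g) x) else None)"

datatype ('l, 'x, 'v) gcmd =
    Guarded "('l, 'x, 'v) gstate \<Rightarrow> bool" "('l, 'x, 'v) action"
  | Oplus "nat set" "nat \<Rightarrow> ('l, 'x, 'v) gcmd"
  | Otimes "nat set" "nat \<Rightarrow> ('l, 'x, 'v) gcmd"

text \<open>The possible effects of a guarded command in a given global state, as partial valuations of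
  the assigned variables; the command is enabled iff there is at least one. In the case of
  \<^const>\<open>Otimes\<close> all components are evaluated in the same state \<open>g\<close> and their assignments are
  united into a single parallel assignment (so there is no effect if the chosen components assign
  different values to the same variable).\<close>

primrec effects :: "('l, 'x, 'v) gcmd \<Rightarrow> ('l, 'x, 'v) gstate \<Rightarrow> ('x \<rightharpoonup> 'v) set" where
  "effects (Guarded B A) g = (if B g then {updates A g} else {})"
| "effects (Oplus L c) g = (\<Union>l\<in>L. effects (c l) g)"
| "effects (Otimes J c) g =
     {u. \<exists>m. (\<forall>j\<in>J. m j \<in> effects (c j) g) \<and> Map.graph u = (\<Union>j\<in>J. Map.graph (m j))}"


section \<open>Concurrent programs\<close>

record ('l, 'x, 'v, 'p) process =
  nodes :: "'l set"
  arcs :: "('l \<times> ('l, 'x, 'v) gcmd \<times> 'l) set"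
  props :: "'p set"
  label :: "'l \<Rightarrow> 'p set"

record ('l, 'x, 'v, 'p) program =
  nprocs :: nat
  init :: "('l, 'x, 'v) gstate set"
  proc :: "nat \<Rightarrow> ('l, 'x, 'v, 'p) process"
  vars :: "'x set"
  vals :: "'x \<Rightarrow> 'v set"

definition global_states :: "('l, 'x, 'v, 'p) program \<Rightarrow> ('l, 'x, 'v) gstate set" where
  "global_states P =
     {g. loc g \<in> (\<Pi>\<^sub>E i\<in>{1..nprocs P}. nodes (proc P i)) \<and> sh g \<in> (\<Pi>\<^sub>E x\<in>vars P. vals P x)}"

primrec wf_gcmd :: "('l, 'x, 'v, 'p) program \<Rightarrow> ('l, 'x, 'v) gcmd \<Rightarrow> bool" where
  "wf_gcmd P (Guarded B A) \<longleftrightarrow>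
     (\<forall>(x, e)\<in>set A. x \<in> vars P \<and> (\<forall>g\<in>global_states P. e g \<in> vals P x))"
| "wf_gcmd P (Oplus L c) \<longleftrightarrow> finite L \<and> (\<forall>l\<in>L. wf_gcmd P (c l))"
| "wf_gcmd P (Otimes J c) \<longleftrightarrow> finite J \<and> (\<forall>j\<in>J. wf_gcmd P (c j))"

definition synchronization_skeleton ::
    "('l, 'x, 'v, 'p) program \<Rightarrow> ('l, 'x, 'v, 'p) process \<Rightarrow> bool" where
  "synchronization_skeleton P p \<longleftrightarrow>
     finite (nodes p) \<and> finite (arcs p) \<and>
     (\<forall>(s, c, t)\<in>arcs p. s \<in> nodes p \<and> t \<in> nodes p \<and> s \<noteq> t \<and> wf_gcmd P c) \<and>
     (\<forall>s\<in>nodes p. \<exists>c t. (s, c, t) \<in> arcs p) \<and>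
     (\<forall>s\<in>nodes p. label p s \<subseteq> props p) \<and>
     inj_on (label p) (nodes p)"

definition finite_state_program :: "('l, 'x, 'v, 'p) program \<Rightarrow> bool" where
  "finite_state_program P \<longleftrightarrow>
     finite (vars P) \<and> (\<forall>x\<in>vars P. finite (vals P x)) \<and>
     (\<forall>i\<in>{1..nprocs P}. synchronization_skeleton P (proc P i)) \<and>
     (\<forall>i\<in>{1..nprocs P}. \<forall>j\<in>{1..nprocs P}. i \<noteq> j \<longrightarrow> props (proc P i) \<inter> props (proc P j) = {}) \<and>
     init P \<subseteq> global_states P"

definition true_props :: "('l, 'x, 'v, 'p) program \<Rightarrow> ('l, 'x, 'v) gstate \<Rightarrow> 'p set" where
  "true_props P g = (\<Union>i\<in>{1..nprocs P}. label (proc P i) (loc g i))"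

definition transitions ::
    "('l, 'x, 'v, 'p) program \<Rightarrow> (('l, 'x, 'v) gstate \<times> nat \<times> ('l, 'x, 'v) gstate) set" where
  "transitions P =
     {(g, i, g'). g \<in> global_states P \<and> i \<in> {1..nprocs P} \<and>
        (\<exists>c t u. (loc g i, c, t) \<in> arcs (proc P i) \<and> u \<in> effects c g \<and>
           g' = \<lparr>loc = (loc g)(i := t),
                 sh = (\<lambda>x. case u x of None \<Rightarrow> sh g x | Some v \<Rightarrow> v)\<rparr>)}"


section \<open>Kripke structures and strong bisimulation\<close>

record ('s, 'p) kripke =
  atoms :: "'p set"
  starts :: "'s set"
  states :: "'s set"
  rel :: "('s \<times> nat \<times> 's) set"
  holds :: "'s \<Rightarrow> 'p set"

definition gstd :: "('l, 'x, 'v, 'p) program \<Rightarrow> (('l, 'x, 'v) gstate, 'p) kripke" where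
  "gstd P =
     (let S = {(g, g'). \<exists>i. (g, i, g') \<in> transitions P}\<^sup>* `` init P
      in \<lparr>atoms = (\<Union>i\<in>{1..nprocs P}. props (proc P i)),
          starts = init P,
          states = S,
          rel = transitions P \<inter> S \<times> {1..nprocs P} \<times> S,
          holds = true_props P\<rparr>)"

definition strong_bisimulation ::
    "('s, 'p) kripke \<Rightarrow> ('t, 'p) kripke \<Rightarrow> ('s \<times> 't) set \<Rightarrow> bool" where
  "strong_bisimulation M M' B \<longleftrightarrow>
     B \<subseteq> states M \<times> states M' \<and>
     (\<forall>(s, s')\<in>B.
        holds M s = holds M' s' \<and>
        (\<forall>i u. (s, i, u) \<in> rel M \<longrightarrow> (\<exists>u'. (s', i, u') \<in> rel M' \<and> (u, u') \<in> B)) \<and>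
        (\<forall>i u'. (s', i, u') \<in> rel M' \<longrightarrow> (\<exists>u. (s, i, u) \<in> rel M \<and> (u, u') \<in> B)))"

definition strongly_bisimilar :: "('s, 'p) kripke \<Rightarrow> ('t, 'p) kripke \<Rightarrow> bool" where
  "strongly_bisimilar M M' \<longleftrightarrow>
     atoms M = atoms M' \<and>
     (\<exists>B. strong_bisimulation M M' B \<and>
        (\<forall>s\<in>starts M. \<exists>s'\<in>starts M'. (s, s') \<in> B) \<and>
        (\<forall>s'\<in>starts M'. \<exists>s\<in>starts M. (s, s') \<in> B))"


section \<open>Pairwise normal form\<close>

text \<open>Since guards and expressions are denotations, referencing a variable means depending on it:
  a variable is read by \<open>f\<close> if changing the value of that variable alone can change the value of
  \<open>f\<close>. For atomic propositions dependence has to be stated for a set of propositions at once,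
  because a change of local state in general changes several of them.\<close>

definition vars_read ::
    "('l, 'x, 'v, 'p) program \<Rightarrow> (('l, 'x, 'v) gstate \<Rightarrow> 'a) \<Rightarrow> 'x set" where
  "vars_read P f =
     {x \<in> vars P. \<exists>g\<in>global_states P. \<exists>h\<in>global_states P.
        loc g = loc h \<and> (\<forall>y. y \<noteq> x \<longrightarrow> sh g y = sh h y) \<and> f g \<noteq> f h}"

primrec vars_accessed :: "('l, 'x, 'v, 'p) program \<Rightarrow> ('l, 'x, 'v) gcmd \<Rightarrow> 'x set" where
  "vars_accessed P (Guarded B A) = vars_read P B \<union> (\<Union>(x, e)\<in>set A. insert x (vars_read P e))"
| "vars_accessed P (Oplus L c) = (\<Union>l\<in>L. vars_accessed P (c l))"
| "vars_accessed P (Otimes J c) = (\<Union>j\<in>J. vars_accessed P (c j))"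

definition process_vars :: "('l, 'x, 'v, 'p) program \<Rightarrow> nat \<Rightarrow> 'x set" where
  "process_vars P i = (\<Union>(s, c, t)\<in>arcs (proc P i). vars_accessed P c)"

definition references_only ::
    "('l, 'x, 'v, 'p) program \<Rightarrow> 'x set \<Rightarrow> 'p set \<Rightarrow> (('l, 'x, 'v) gstate \<Rightarrow> 'a) \<Rightarrow> bool" where
  "references_only P X AP f \<longleftrightarrow>
     (\<forall>g\<in>global_states P. \<forall>h\<in>global_states P.
        (\<forall>x\<in>X. sh g x = sh h x) \<and> true_props P g \<inter> AP = true_props P h \<inter> AP \<longrightarrow> f g = f h)"

text \<open>\<open>SH i j\<close> is the set of variables shared by exactly the two processes \<open>i\<close> and \<open>j\<close>: it
  contains all variables accessed by both of them, and no other process accesses any of its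
  elements.\<close>

definition pairwise_sharing ::
    "('l, 'x, 'v, 'p) program \<Rightarrow> (nat \<times> nat) set \<Rightarrow> (nat \<Rightarrow> nat \<Rightarrow> 'x set) \<Rightarrow> bool" where
  "pairwise_sharing P I SH \<longleftrightarrow>
     (\<forall>(i, j)\<in>I.
        SH i j \<subseteq> vars P \<and> SH i j = SH j i \<and>
        process_vars P i \<inter> process_vars P j \<subseteq> SH i j \<and>
        (\<forall>k\<in>{1..nprocs P} - {i, j}. process_vars P k \<inter> SH i j = {}))"

definition pairwise_command ::
    "('l, 'x, 'v, 'p) program \<Rightarrow> (nat \<times> nat) set \<Rightarrow> (nat \<Rightarrow> nat \<Rightarrow> 'x set) \<Rightarrow> nat \<Rightarrow>
      ('l, 'x, 'v) gcmd \<Rightarrow> bool" where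
  "pairwise_command P I SH i c \<longleftrightarrow>
     (\<exists>n B A.
        c = Otimes (I `` {i}) (\<lambda>j. Oplus {1..n j} (\<lambda>l. Guarded (B j l) (A j l))) \<and>
        (\<forall>j\<in>I `` {i}. 1 \<le> n j \<and>
           (\<forall>l\<in>{1..n j}. references_only P (SH i j) (props (proc P j)) (B j l) \<and>
              fst ` set (A j l) \<subseteq> SH i j)))"

definition pairwise_normal_form_wrt ::
    "('l, 'x, 'v, 'p) program \<Rightarrow> (nat \<times> nat) set \<Rightarrow> bool" where
  "pairwise_normal_form_wrt P I \<longleftrightarrow>
     (\<exists>SH. pairwise_sharing P I SH \<and>
        (\<forall>i\<in>{1..nprocs P}. \<forall>(s, c, t)\<in>arcs (proc P i). pairwise_command P I SH i c))"

definition pairwise_normal_form :: "('l, 'x, 'v, 'p) program \<Rightarrow> bool" where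
  "pairwise_normal_form P \<longleftrightarrow>
     (\<exists>I. I \<subseteq> {1..nprocs P} \<times> {1..nprocs P} \<and> irrefl I \<and> sym I \<and> pairwise_normal_form_wrt P I)"

end

theory Submission
  imports Defs "HOL-Library.Nat_Bijection"
begin

text \<open>
  Code the valuations of the shared variables of \<open>Q\<close> by residues modulo \<open>N\<close>, and let \<open>PP\<close> have
  one residue-valued variable \<open>y a k\<close> for each ordered pair of distinct processes, accessed by
  \<open>a\<close> and \<open>k\<close> only. The invariant is that for \<^emph>\<open>every\<close> \<open>k\<close> the sum of \<open>y a k\<close> over \<open>a \<noteq> k\<close> is the
  code of the current valuation, so each process can recover the whole valuation from variables it
  shares with single other processes. When \<open>i\<close> changes the code by \<open>d\<close>, it adds \<open>d\<close> to \<open>y i k\<close> for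
  all \<open>k \<noteq> i\<close>, and to one variable \<open>y a i\<close>: every sum then contains exactly one modified term, and
  \<open>i\<close> has write access to all of them. Finally, a guard over everything that \<open>i\<close> sees is a
  disjunction of conjunctions of pairwise guards, and the disjunction is expressed by parallel arcs,
  one for each guess of the state.
\<close>

section \<open>Typing and finiteness of global states, for arbitrary programs\<close>

definition apply_update :: "('x \<rightharpoonup> 'v) \<Rightarrow> ('x \<Rightarrow> 'v) \<Rightarrow> 'x \<Rightarrow> 'v" where
  "apply_update u f = (\<lambda>x. case u x of None \<Rightarrow> f x | Some v \<Rightarrow> v)"

lemma exec_global_states:
  assumes "\<forall>(x, e)\<in>set A. x \<in> vars P \<and> (\<forall>g\<in>global_states P. e g \<in> vals P x)"
    and "g \<in> global_states P"
  shows "exec A g \<in> global_states P"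
  using assms
proof (induction A g rule: exec.induct)
  case (2 x e A g)
  have "g\<lparr>sh := (sh g)(x := e g)\<rparr> \<in> global_states P"
    using 2(2,3) by (auto simp: global_states_def PiE_iff extensional_def)
  then show ?case
    using 2 by simp
qed simp

text \<open>By induction on the command; in the \<open>Otimes\<close> case each binding of the
  united effect comes from some component.\<close>

lemma effects_well_typed:
  assumes "wf_gcmd P c" "g \<in> global_states P" "u \<in> effects c g" "u x = Some v"
  shows "x \<in> vars P \<and> v \<in> vals P x"
  using assms
proof (induction c arbitrary: u x v)
  case (Guarded B A)
  have "exec A g \<in> global_states P"
    using Guarded.prems by (intro exec_global_states) auto
  moreover have "x \<in> vars P" "v = sh (exec A g) x"
    using Guarded.prems by (auto simp: updates_def split: if_splits)
  ultimately show ?case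
    by (auto simp: global_states_def PiE_iff)
next
  case (Oplus L c)
  then obtain l where "l \<in> L" "u \<in> effects (c l) g"
    by auto
  then show ?case
    using Oplus.IH[of "c l" u x v] Oplus.prems by simp
next
  case (Otimes J c)
  then obtain m where m: "\<forall>j\<in>J. m j \<in> effects (c j) g"
    and u: "Map.graph u = (\<Union>j\<in>J. Map.graph (m j))"
    by auto
  have "(x, v) \<in> Map.graph u"
    using Otimes.prems by (simp add: in_graphI)
  then obtain j where "j \<in> J" "m j x = Some v"
    unfolding u by (auto dest: in_graphD)
  then show ?case
    using Otimes.IH[of "c j" "m j" x v] Otimes.prems m by auto
qed

lemma global_states_successor:
  assumes "finite_state_program P" "g \<in> global_states P" "i \<in> {1..nprocs P}"
    and "(loc g i, c, t) \<in> arcs (proc P i)" "u \<in> effects c g"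
  shows "\<lparr>loc = (loc g)(i := t), sh = apply_update u (sh g)\<rparr> \<in> global_states P"
proof -
  have wf: "wf_gcmd P c" and t: "t \<in> nodes (proc P i)"
    using assms(1,3,4) by (fastforce simp: finite_state_program_def synchronization_skeleton_def)+
  have "apply_update u (sh g) \<in> (\<Pi>\<^sub>E x\<in>vars P. vals P x)"
    using effects_well_typed[OF wf assms(2,5)] assms(2)
    by (auto simp: apply_update_def global_states_def PiE_iff extensional_def split: option.splits)
  then show ?thesis
    using assms(2,3) t by (auto simp: global_states_def PiE_iff extensional_def)
qed

text \<open>Assumes finiteness of the components only, since it is applied to \<open>PP\<close>
  before \<open>PP\<close> is known to be a finite-state program.\<close>

lemma finite_global_states:
  assumes "\<And>i. i \<in> {1..nprocs P} \<Longrightarrow> finite (nodes (proc P i))"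
    and "finite (vars P)" "\<And>x. x \<in> vars P \<Longrightarrow> finite (vals P x)"
  shows "finite (global_states P)"
proof -
  have "finite ((\<lambda>(l, s). \<lparr>loc = l, sh = s\<rparr>) `
      ((\<Pi>\<^sub>E i\<in>{1..nprocs P}. nodes (proc P i)) \<times> (\<Pi>\<^sub>E x\<in>vars P. vals P x)))"
    by (intro finite_imageI finite_cartesian_product finite_PiE assms) auto
  moreover have "global_states P \<subseteq> (\<lambda>(l, s). \<lparr>loc = l, sh = s\<rparr>) `
      ((\<Pi>\<^sub>E i\<in>{1..nprocs P}. nodes (proc P i)) \<times> (\<Pi>\<^sub>E x\<in>vars P. vals P x))"
  proof
    fix g assume "g \<in> global_states P"
    then show "g \<in> (\<lambda>(l, s). \<lparr>loc = l, sh = s\<rparr>) `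
      ((\<Pi>\<^sub>E i\<in>{1..nprocs P}. nodes (proc P i)) \<times> (\<Pi>\<^sub>E x\<in>vars P. vals P x))"
      by (intro image_eqI[where x = "(loc g, sh g)"]) (auto simp: global_states_def)
  qed
  ultimately show ?thesis
    using finite_subset by blast
qed

section \<open>Reachability in transition diagrams\<close>

lemma gstd_simps [simp]:
  "atoms (gstd P) = (\<Union>i\<in>{1..nprocs P}. props (proc P i))"
  "starts (gstd P) = init P"
  "holds (gstd P) = true_props P"
  by (simp_all add: gstd_def Let_def)

lemma init_subset_states: "init P \<subseteq> states (gstd P)"
  by (auto simp: gstd_def Let_def)

text \<open>Reachability is closed under transitions, so only the source has to be checked.\<close>

lemma rel_gstd_iff:
  "(g, i, g') \<in> rel (gstd P) \<longleftrightarrow> g \<in> states (gstd P) \<and> (g, i, g') \<in> transitions P"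
proof
  assume "g \<in> states (gstd P) \<and> (g, i, g') \<in> transitions P"
  then have g: "g \<in> {(g, g'). \<exists>i. (g, i, g') \<in> transitions P}\<^sup>* `` init P"
    and tr: "(g, i, g') \<in> transitions P"
    by (auto simp: gstd_def Let_def)
  have "i \<in> {1..nprocs P}"
    using tr by (auto simp: transitions_def)
  moreover have "g' \<in> {(g, g'). \<exists>i. (g, i, g') \<in> transitions P}\<^sup>* `` init P"
    using g tr by (auto intro: rtrancl_into_rtrancl)
  ultimately show "(g, i, g') \<in> rel (gstd P)"
    using g tr by (simp add: gstd_def Let_def)
qed (auto simp: gstd_def Let_def)

lemma rel_gstd_target: "(g, i, g') \<in> rel (gstd P) \<Longrightarrow> g' \<in> states (gstd P)"
  by (auto simp: gstd_def Let_def)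

lemma transitionsI:
  assumes "g \<in> global_states P" "i \<in> {1..nprocs P}"
    and "(loc g i, c, t) \<in> arcs (proc P i)" "u \<in> effects c g"
  shows "(g, i, \<lparr>loc = (loc g)(i := t), sh = apply_update u (sh g)\<rparr>) \<in> transitions P"
  using assms by (auto simp: transitions_def apply_update_def)

lemma transitionsE:
  assumes "(g, i, g') \<in> transitions P"
  obtains c t u where "g \<in> global_states P" "i \<in> {1..nprocs P}"
    and "(loc g i, c, t) \<in> arcs (proc P i)" "u \<in> effects c g"
    and "g' = \<lparr>loc = (loc g)(i := t), sh = apply_update u (sh g)\<rparr>"
  using assms by (auto simp: transitions_def apply_update_def)

section \<open>The construction of \<open>PP\<close>\<close>

locale coded_program =
  fixes Q :: "('l, 'x, 'v, 'p) program"
    and N :: nat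
    and enc :: "('x \<Rightarrow> 'v) \<Rightarrow> nat"
  assumes fin: "finite_state_program Q"
    and nprocs: "2 \<le> nprocs Q"
    and N_pos: "0 < N"
    and enc_inj: "inj_on enc (\<Pi>\<^sub>E x\<in>vars Q. vals Q x)"
    and enc_less: "\<And>f. f \<in> (\<Pi>\<^sub>E x\<in>vars Q. vals Q x) \<Longrightarrow> enc f < N"
begin

abbreviation procs :: "nat set" where
  "procs \<equiv> {1..nprocs Q}"

text \<open>The variables of \<open>PP\<close> are named by natural numbers; pairing gives distinct
  names to distinct ordered pairs. \<open>y a k\<close> is the summand indexed by \<open>a\<close>
  in the sum that \<open>k\<close> reads.\<close>

abbreviation y :: "nat \<Rightarrow> nat \<Rightarrow> nat" where
  "y a k \<equiv> prod_encode (a, k)"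

definition pair_vars :: "nat set" where
  "pair_vars = {y a k | a k. a \<in> procs \<and> k \<in> procs \<and> a \<noteq> k}"

definition vars_of :: "nat \<Rightarrow> nat set" where
  "vars_of i = (\<Union>j\<in>procs - {i}. {y i j, y j i})"

definition row_sum :: "nat \<Rightarrow> (nat \<Rightarrow> nat) \<Rightarrow> nat" where
  "row_sum k f = (\<Sum>a\<in>procs - {k}. f (y a k)) mod N"

text \<open>Selects the summand of the sum for \<open>k\<close> that \<open>i\<close> modifies. For
  \<open>k = i\<close> there is no variable \<open>y i i\<close>, so a partner's summand
  \<open>y 1 i\<close> or \<open>y 2 i\<close> is used; it exists because there are at least two
  processes.\<close>

definition writer :: "nat \<Rightarrow> nat \<Rightarrow> nat" where
  "writer i k = (if k \<noteq> i then i else if i = 1 then 2 else 1)"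

definition bump :: "nat \<Rightarrow> nat \<Rightarrow> (nat \<Rightarrow> nat) \<Rightarrow> nat \<Rightarrow> nat" where
  "bump i d f = (\<lambda>x. if x \<in> (\<lambda>k. y (writer i k) k) ` procs then (f x + d) mod N else f x)"

lemma writer: "i \<in> procs \<Longrightarrow> writer i k \<in> procs - {k}"
  using nprocs by (auto simp: writer_def)

lemma writer_in_vars_of: "i \<in> procs \<Longrightarrow> k \<in> procs \<Longrightarrow> y (writer i k) k \<in> vars_of i"
  using nprocs by (auto simp: writer_def vars_of_def)

text \<open>Injectivity of \<open>prod_encode\<close> makes \<open>y (writer i k) k\<close> the only
  bumped summand of the sum for \<open>k\<close>, so it is split off from the rest.\<close>

lemma row_sum_bump:
  assumes "i \<in> procs" "k \<in> procs"
  shows "row_sum k (bump i d f) = (row_sum k f + d) mod N"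
proof -
  let ?w = "writer i k"
  let ?S = "\<lambda>f. \<Sum>a\<in>procs - {k} - {?w}. f (y a k)"
  have split: "row_sum k h = (h (y ?w k) + ?S h) mod N" for h
    unfolding row_sum_def using writer[OF assms(1)] by (subst sum.remove[of _ ?w]) auto
  have "?S (bump i d f) = ?S f"
    by (intro sum.cong) (auto simp: bump_def)
  moreover have "bump i d f (y ?w k) = (f (y ?w k) + d) mod N"
    using assms by (simp add: bump_def)
  ultimately show ?thesis
    by (simp add: split mod_simps ac_simps)
qed

text \<open>The global states of \<open>PP\<close>, written out beforehand because the arcs of
  \<open>PP\<close> range over them.\<close>

definition pp_states :: "('l, nat, nat) gstate set" where
  "pp_states = {h. loc h \<in> (\<Pi>\<^sub>E i\<in>procs. nodes (proc Q i)) \<and> sh h \<in> (\<Pi>\<^sub>E x\<in>pair_vars. {..<N})}"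

text \<open>What \<open>i\<close> takes the state of \<open>Q\<close> to be. If the sum is not a
  code, \<open>inv_into\<close> yields an arbitrary valuation; decoding is claimed correct only for
  represented states.\<close>

definition decode :: "nat \<Rightarrow> ('l, nat, nat) gstate \<Rightarrow> ('l, 'x, 'v) gstate" where
  "decode i h =
     \<lparr>loc = loc h, sh = inv_into (\<Pi>\<^sub>E x\<in>vars Q. vals Q x) enc (row_sum i (sh h))\<rparr>"

text \<open>Tests only what \<open>j\<close> shows to \<open>i\<close>: its local state and two
  variables. Together with the source node of the arc, the tests for all \<open>j\<close> fix
  everything \<open>i\<close> sees. The flag \<open>b\<close> gives disabled arcs the same shape as
  the others.\<close>

definition cmd_guard ::
    "nat \<Rightarrow> bool \<Rightarrow> ('l, nat, nat) gstate \<Rightarrow> nat \<Rightarrow> ('l, nat, nat) gstate \<Rightarrow> bool" where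
  "cmd_guard i b \<sigma> j = (\<lambda>h. b \<and> loc h j = loc \<sigma> j \<and>
     sh h (y i j) = sh \<sigma> (y i j) \<and> sh h (y j i) = sh \<sigma> (y j i))"

text \<open>Since the guards pin down the part of the state seen by \<open>i\<close>, the assigned values can be
  constants.\<close>

definition cmd_action ::
    "nat \<Rightarrow> ('l, nat, nat) gstate \<Rightarrow> nat \<Rightarrow> nat \<Rightarrow> ('l, nat, nat) action" where
  "cmd_action i \<sigma> d j =
     [(y i j, \<lambda>_. bump i d (sh \<sigma>) (y i j) mod N), (y j i, \<lambda>_. bump i d (sh \<sigma>) (y j i) mod N)]"

text \<open>One alternative per \<open>Oplus\<close>: alternatives of different components are
  chosen independently and could mix parts of different guesses.\<close>

definition cmd :: "nat \<Rightarrow> bool \<Rightarrow> ('l, nat, nat) gstate \<Rightarrow> nat \<Rightarrow> ('l, nat, nat) gcmd" where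
  "cmd i b \<sigma> d = Otimes (procs - {i})
     (\<lambda>j. Oplus {1..1} (\<lambda>l. Guarded (cmd_guard i b \<sigma> j) (cmd_action i \<sigma> d j)))"

text \<open>The arcs with guard \<open>False\<close> only ensure that every node has an outgoing arc.\<close>

definition pp_arcs :: "nat \<Rightarrow> ('l \<times> ('l, nat, nat) gcmd \<times> 'l) set" where
  "pp_arcs i =
     {(s, cmd i False undefined 0, t) | s c t. (s, c, t) \<in> arcs (proc Q i)} \<union>
     {(s, cmd i True \<sigma> d, t) | s c t \<sigma> d u. (s, c, t) \<in> arcs (proc Q i) \<and> \<sigma> \<in> pp_states \<and>
        d < N \<and> loc \<sigma> i = s \<and> u \<in> effects c (decode i \<sigma>) \<and>
        enc (apply_update u (sh (decode i \<sigma>))) = (row_sum i (sh \<sigma>) + d) mod N}"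

text \<open>One bump of the zero valuation sets all sums at once; the choice of process 1 is
  arbitrary.\<close>

definition pp_init :: "('l, 'x, 'v) gstate \<Rightarrow> ('l, nat, nat) gstate" where
  "pp_init g = \<lparr>loc = loc g, sh = bump 1 (enc (sh g)) (\<lambda>x\<in>pair_vars. 0)\<rparr>"

definition PP :: "('l, nat, nat, 'p) program" where
  "PP = \<lparr>nprocs = nprocs Q, init = pp_init ` init Q,
     proc = (\<lambda>i. \<lparr>nodes = nodes (proc Q i), arcs = pp_arcs i,
                  props = props (proc Q i), label = label (proc Q i)\<rparr>),
     vars = pair_vars, vals = (\<lambda>_. {..<N})\<rparr>"

section \<open>\<open>PP\<close> is a finite-state program\<close>

lemma PP_simps [simp]:
  "nprocs PP = nprocs Q" "init PP = pp_init ` init Q"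
  "nodes (proc PP i) = nodes (proc Q i)" "arcs (proc PP i) = pp_arcs i"
  "props (proc PP i) = props (proc Q i)" "label (proc PP i) = label (proc Q i)"
  "vars PP = pair_vars" "vals PP x = {..<N}"
  by (simp_all add: PP_def)

lemma global_states_PP: "global_states PP = pp_states"
  by (simp add: global_states_def pp_states_def)

lemma skeleton: "i \<in> procs \<Longrightarrow> synchronization_skeleton Q (proc Q i)"
  using fin by (simp add: finite_state_program_def)

lemma finite_pair_vars: "finite pair_vars"
proof -
  have "pair_vars \<subseteq> prod_encode ` (procs \<times> procs)"
    by (auto simp: pair_vars_def)
  then show ?thesis
    by (rule finite_subset) auto
qed

lemma vars_of_subset: "i \<in> procs \<Longrightarrow> vars_of i \<subseteq> pair_vars"
  by (auto simp: vars_of_def pair_vars_def)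

lemma finite_pp_states: "finite pp_states"
  unfolding global_states_PP[symmetric]
  by (rule finite_global_states)
    (use skeleton finite_pair_vars in \<open>auto simp: synchronization_skeleton_def\<close>)

lemma bump_PiE:
  assumes "i \<in> procs" "f \<in> (\<Pi>\<^sub>E x\<in>pair_vars. {..<N})"
  shows "bump i d f \<in> (\<Pi>\<^sub>E x\<in>pair_vars. {..<N})"
proof -
  have "(\<lambda>k. y (writer i k) k) ` procs \<subseteq> pair_vars"
    using writer_in_vars_of[OF assms(1)] vars_of_subset[OF assms(1)] by blast
  then show ?thesis
    using assms(2) N_pos by (auto simp: bump_def PiE_iff extensional_def)
qed

lemma pp_init_in_pp_states: "g \<in> global_states Q \<Longrightarrow> pp_init g \<in> pp_states"
  using bump_PiE[of 1 "\<lambda>x\<in>pair_vars. 0" "enc (sh g)"] nprocs N_pos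
  by (auto simp: pp_states_def pp_init_def global_states_def)

lemma row_sum_pp_init:
  assumes "g \<in> global_states Q" "k \<in> procs"
  shows "row_sum k (sh (pp_init g)) = enc (sh g)"
proof -
  have "row_sum k (\<lambda>x\<in>pair_vars. 0) = 0"
    using assms(2) by (auto simp: row_sum_def pair_vars_def intro!: sum.neutral)
  moreover have "enc (sh g) < N"
    using assms(1) by (intro enc_less) (simp add: global_states_def)
  ultimately show ?thesis
    using assms(2) nprocs by (simp add: pp_init_def row_sum_bump)
qed

text \<open>Holds for every \<open>\<sigma>\<close>, even the \<open>undefined\<close> of the
  disabled arcs, because the assigned constants are reduced modulo \<open>N\<close>.\<close>

lemma wf_cmd: "i \<in> procs \<Longrightarrow> wf_gcmd PP (cmd i b \<sigma> d)"
  using N_pos by (auto simp: cmd_def cmd_action_def pair_vars_def)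

lemma finite_pp_arcs:
  assumes "i \<in> procs"
  shows "finite (pp_arcs i)"
proof -
  \<comment> \<open>\<open>insert undefined\<close> and the offset 0, which is below the positive
    \<open>N\<close>, cover the disabled arcs.\<close>
  have "pp_arcs i \<subseteq> (\<lambda>((s, c, t), b, \<sigma>, d). (s, cmd i b \<sigma> d, t)) `
      (arcs (proc Q i) \<times> UNIV \<times> insert undefined pp_states \<times> {..<N})"
    using N_pos by (force simp: pp_arcs_def image_iff)
  then show ?thesis
    by (rule finite_subset)
      (use skeleton[OF assms] finite_pp_states in \<open>auto simp: synchronization_skeleton_def\<close>)
qed

text \<open>Keeps only the shape of the command: well-formedness and normal form hold for all
  \<open>b\<close>, \<open>\<sigma>\<close> and \<open>d\<close>.\<close>

lemma pp_arcs_cases: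
  assumes "(s, c', t) \<in> pp_arcs i"
  obtains c b \<sigma> d where "c' = cmd i b \<sigma> d" "(s, c, t) \<in> arcs (proc Q i)"
  using assms unfolding pp_arcs_def by blast

lemma synchronization_skeleton_PP:
  assumes "i \<in> procs"
  shows "synchronization_skeleton PP (proc PP i)"
proof -
  note sk = skeleton[OF assms, unfolded synchronization_skeleton_def]
  have "s \<in> nodes (proc Q i) \<and> t \<in> nodes (proc Q i) \<and> s \<noteq> t \<and> wf_gcmd PP c'"
    if arc: "(s, c', t) \<in> pp_arcs i" for s c' t
  proof -
    obtain c b \<sigma> d where "c' = cmd i b \<sigma> d" "(s, c, t) \<in> arcs (proc Q i)"
      using arc by (rule pp_arcs_cases)
    then show ?thesis
      using sk wf_cmd[OF assms] by fastforce
  qed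
  moreover have "\<exists>c t. (s, c, t) \<in> pp_arcs i" if "s \<in> nodes (proc Q i)" for s
  proof -
    have "\<exists>c t. (s, c, t) \<in> arcs (proc Q i)"
      using sk that by simp
    then obtain c t where "(s, c, t) \<in> arcs (proc Q i)"
      by (elim exE)
    then have "(s, cmd i False undefined 0, t) \<in> pp_arcs i"
      by (auto simp: pp_arcs_def)
    then show ?thesis
      by blast
  qed
  ultimately show ?thesis
    using sk finite_pp_arcs[OF assms] by (auto simp: synchronization_skeleton_def)
qed

lemma finite_state_program_PP: "finite_state_program PP"
  using fin finite_pair_vars pp_init_in_pp_states synchronization_skeleton_PP
  by (auto simp: finite_state_program_def global_states_PP)

section \<open>Effects of the commands of \<open>PP\<close>\<close>

lemma updates_cmd_action:
  assumes "i \<noteq> j"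
  shows "updates (cmd_action i \<sigma> d j) h =
    (\<lambda>x. if x \<in> {y i j, y j i} then Some (bump i d (sh \<sigma>) x mod N) else None)"
  using assms by (auto simp: updates_def cmd_action_def fun_eq_iff)

text \<open>All components take their constants from the one valuation
  \<open>bump i d (sh \<sigma>)\<close>, so they never conflict, and the union of their graphs is
  the graph of a map on \<open>vars_of i\<close>. Hence there is exactly one effect, or
  none.\<close>

lemma effects_cmd:
  assumes "i \<in> procs"
  shows "effects (cmd i b \<sigma> d) h =
    (if \<forall>j\<in>procs - {i}. cmd_guard i b \<sigma> j h
     then {\<lambda>x. if x \<in> vars_of i then Some (bump i d (sh \<sigma>) x mod N) else None} else {})"
    (is "_ = (if ?G then {?u} else {})")
proof (cases ?G)
  case True
  let ?m = "\<lambda>j x. if x \<in> {y i j, y j i} then Some (bump i d (sh \<sigma>) x mod N) else None"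
  have graph: "Map.graph ?u = (\<Union>j\<in>procs - {i}. Map.graph (?m j))"
    by (auto simp: graph_def vars_of_def split: if_splits)
  have inj: "u = ?u" if "Map.graph u = Map.graph ?u" for u
  proof
    fix x
    have "u x = Some v \<longleftrightarrow> ?u x = Some v" for v
      using that in_graphI[of u] in_graphD[of x v u] in_graphI[of ?u] in_graphD[of x v ?u] by metis
    then show "u x = ?u x"
      by (metis not_None_eq)
  qed
  have "effects (cmd i b \<sigma> d) h = {u. \<exists>m. (\<forall>j\<in>procs - {i}. m j = ?m j) \<and>
      Map.graph u = (\<Union>j\<in>procs - {i}. Map.graph (m j))}"
    using True by (simp add: cmd_def updates_cmd_action)
  also have "\<dots> = {u. Map.graph u = (\<Union>j\<in>procs - {i}. Map.graph (?m j))}"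
  proof (intro Collect_cong iffI)
    fix u
    assume "\<exists>m. (\<forall>j\<in>procs - {i}. m j = ?m j) \<and>
      Map.graph u = (\<Union>j\<in>procs - {i}. Map.graph (m j))"
    then obtain m where "\<And>j. j \<in> procs - {i} \<Longrightarrow> m j = ?m j"
      and u: "Map.graph u = (\<Union>j\<in>procs - {i}. Map.graph (m j))"
      by blast
    then show "Map.graph u = (\<Union>j\<in>procs - {i}. Map.graph (?m j))"
      unfolding u by (intro SUP_cong) simp_all
  next
    fix u
    assume "Map.graph u = (\<Union>j\<in>procs - {i}. Map.graph (?m j))"
    then show "\<exists>m. (\<forall>j\<in>procs - {i}. m j = ?m j) \<and>
        Map.graph u = (\<Union>j\<in>procs - {i}. Map.graph (m j))"
      by (intro exI[of _ ?m]) simp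
  qed
  also have "\<dots> = {?u}"
    unfolding graph[symmetric] using inj by blast
  finally show ?thesis
    using True by simp
next
  case False
  then show ?thesis
    by (auto simp: cmd_def)
qed

text \<open>An effect exists only if the guards hold; then \<open>h\<close> agrees with
  \<open>\<sigma>\<close> on \<open>vars_of i\<close>, and the constants are the bumped values of
  \<open>h\<close>. Elsewhere \<open>bump\<close> changes nothing, as all bumped variables lie in
  \<open>vars_of i\<close>.\<close>

lemma apply_update_cmd:
  assumes "i \<in> procs" "h \<in> pp_states" "u \<in> effects (cmd i b \<sigma> d) h"
  shows "apply_update u (sh h) = bump i d (sh h)"
proof
  fix x
  have u: "u = (\<lambda>x. if x \<in> vars_of i then Some (bump i d (sh \<sigma>) x mod N) else None)"
    and guards: "\<forall>j\<in>procs - {i}. cmd_guard i b \<sigma> j h"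
    using assms(3) unfolding effects_cmd[OF assms(1)] by (auto split: if_splits)
  show "apply_update u (sh h) x = bump i d (sh h) x"
  proof (cases "x \<in> vars_of i")
    case True
    then have "sh h x = sh \<sigma> x"
      using guards by (auto simp: vars_of_def cmd_guard_def)
    \<comment> \<open>Hence the extra \<open>mod N\<close> in the assigned constant has no
      effect.\<close>
    moreover have "bump i d (sh h) x < N"
      using bump_PiE[OF assms(1), of "sh h" d] assms(2) True vars_of_subset[OF assms(1)]
      by (auto simp: pp_states_def PiE_iff)
    ultimately show ?thesis
      using True by (auto simp: u apply_update_def bump_def)
  next
    case False
    then have "x \<notin> (\<lambda>k. y (writer i k) k) ` procs"
      using writer_in_vars_of[OF assms(1)] by blast
    with False show ?thesis
      by (simp add: u apply_update_def bump_def)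
  qed
qed

section \<open>Pairwise normal form of \<open>PP\<close>\<close>

lemma vars_read_guard: "vars_read PP (cmd_guard i b \<sigma> j) \<subseteq> {y i j, y j i}"
proof
  fix x
  assume "x \<in> vars_read PP (cmd_guard i b \<sigma> j)"
  then obtain g h :: "('l, nat, nat) gstate" where "loc g = loc h"
    and "\<forall>y. y \<noteq> x \<longrightarrow> sh g y = sh h y"
    and "cmd_guard i b \<sigma> j g \<noteq> cmd_guard i b \<sigma> j h"
    unfolding vars_read_def by blast
  then show "x \<in> {y i j, y j i}"
    by (auto simp: cmd_guard_def)
qed

lemma process_vars_PP: "process_vars PP i \<subseteq> vars_of i"
proof -
  have "vars_accessed PP (cmd i b \<sigma> d) \<subseteq> vars_of i" for b \<sigma> d
  proof -
    \<comment> \<open>Constant right-hand sides read nothing, so an action accesses just its two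
      targets.\<close>
    have const: "vars_read PP (\<lambda>_. v) = {}" for v :: nat
      by (simp add: vars_read_def)
    have "vars_accessed PP (cmd i b \<sigma> d) = (\<Union>j\<in>procs - {i}.
        vars_read PP (cmd_guard i b \<sigma> j) \<union> {y i j, y j i})"
      by (simp add: cmd_def cmd_action_def const insert_commute)
    also have "\<dots> \<subseteq> vars_of i"
      unfolding vars_of_def by (intro UN_mono order_refl Un_least vars_read_guard)
    finally show ?thesis .
  qed
  then show ?thesis
    unfolding process_vars_def by (fastforce elim: pp_arcs_cases)
qed

text \<open>The tested local state of \<open>j\<close> must be visible through the propositions of
  \<open>j\<close>. Disjointness of the proposition sets isolates the label of \<open>j\<close>, and
  injectivity of the labelling recovers the node.\<close>

lemma references_only_guard:
  assumes "j \<in> procs"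
  shows "references_only PP {y i j, y j i} (props (proc PP j)) (cmd_guard i b \<sigma> j)"
  unfolding references_only_def
proof (intro ballI impI)
  fix g h
  assume gh: "g \<in> global_states PP" "h \<in> global_states PP"
    and eq: "(\<forall>x\<in>{y i j, y j i}. sh g x = sh h x) \<and>
      true_props PP g \<inter> props (proc PP j) = true_props PP h \<inter> props (proc PP j)"
  have props: "true_props PP f \<inter> props (proc PP j) = label (proc Q j) (loc f j)"
    and node: "loc f j \<in> nodes (proc Q j)"
    if "f \<in> global_states PP" for f
  proof -
    have f: "loc f k \<in> nodes (proc Q k)" if "k \<in> procs" for k
      using \<open>f \<in> global_states PP\<close> that by (auto simp: global_states_PP pp_states_def PiE_iff)
    then have lab: "label (proc Q k) (loc f k) \<subseteq> props (proc Q k)" if "k \<in> procs" for k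
      using that skeleton[OF that] by (simp add: synchronization_skeleton_def)
    have disj: "props (proc Q k) \<inter> props (proc Q j) = {}" if "k \<in> procs" "k \<noteq> j" for k
      using fin assms that by (simp add: finite_state_program_def)
    show "true_props PP f \<inter> props (proc PP j) = label (proc Q j) (loc f j)"
    proof
      show "true_props PP f \<inter> props (proc PP j) \<subseteq> label (proc Q j) (loc f j)"
      proof
        fix p assume "p \<in> true_props PP f \<inter> props (proc PP j)"
        then obtain k where "k \<in> procs" "p \<in> label (proc Q k) (loc f k)" "p \<in> props (proc Q j)"
          by (auto simp: true_props_def)
        then show "p \<in> label (proc Q j) (loc f j)"
          using lab disj by (cases "k = j") blast+
      qed
      show "label (proc Q j) (loc f j) \<subseteq> true_props PP f \<inter> props (proc PP j)"
        using lab[OF assms] assms by (auto simp: true_props_def)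
    qed
    show "loc f j \<in> nodes (proc Q j)"
      using f assms .
  qed
  have "inj_on (label (proc Q j)) (nodes (proc Q j))"
    using skeleton[OF assms] by (simp add: synchronization_skeleton_def)
  then have "loc g j = loc h j"
    using props[OF gh(1)] props[OF gh(2)] node[OF gh(1)] node[OF gh(2)] eq
    by (metis inj_onD)
  then show "cmd_guard i b \<sigma> j g = cmd_guard i b \<sigma> j h"
    using eq by (simp add: cmd_guard_def)
qed

lemma pairwise_normal_form_PP: "pairwise_normal_form PP"
proof -
  \<comment> \<open>The complete graph: every two distinct processes share variables.\<close>
  define I where "I = {(i, j). i \<in> procs \<and> j \<in> procs \<and> i \<noteq> j}"
  define SH where "SH i j = {y i j, y j i}" for i j
  have I_image: "I `` {i} = procs - {i}" if "i \<in> procs" for i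
    using that by (auto simp: I_def)
  have "pairwise_sharing PP I SH"
    unfolding pairwise_sharing_def
  proof (clarify)
    fix i j assume ij: "(i, j) \<in> I"
    have "SH i j \<subseteq> vars PP" "SH i j = SH j i"
      using ij by (auto simp: SH_def I_def pair_vars_def)
    moreover have "process_vars PP i \<inter> process_vars PP j \<subseteq> SH i j"
    proof -
      \<comment> \<open>For distinct \<open>i\<close> and \<open>j\<close>, a pair containing both
        indices is \<open>(i, j)\<close> or \<open>(j, i)\<close>.\<close>
      have "vars_of i \<inter> vars_of j \<subseteq> SH i j"
        using ij by (auto simp: vars_of_def SH_def I_def)
      then show ?thesis
        using process_vars_PP by blast
    qed
    moreover have "process_vars PP k \<inter> SH i j = {}" if "k \<in> {1..nprocs PP} - {i, j}" for k
    proof -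
      have "vars_of k \<inter> SH i j = {}"
        using that by (auto simp: vars_of_def SH_def)
      then show ?thesis
        using process_vars_PP by blast
    qed
    ultimately show "SH i j \<subseteq> vars PP \<and> SH i j = SH j i \<and>
        process_vars PP i \<inter> process_vars PP j \<subseteq> SH i j \<and>
        (\<forall>k\<in>{1..nprocs PP} - {i, j}. process_vars PP k \<inter> SH i j = {})"
      by blast
  qed
  moreover have "pairwise_command PP I SH i (cmd i b \<sigma> d)" if "i \<in> procs" for i b \<sigma> d
    unfolding pairwise_command_def
  proof (intro exI conjI)
    show "cmd i b \<sigma> d = Otimes (I `` {i}) (\<lambda>j. Oplus {1..(\<lambda>_. 1 :: nat) j}
        (\<lambda>l. Guarded ((\<lambda>j _. cmd_guard i b \<sigma> j) j l) ((\<lambda>j _. cmd_action i \<sigma> d j) j l)))"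
      by (simp add: cmd_def I_image[OF that])
    show "\<forall>j\<in>I `` {i}. 1 \<le> (\<lambda>_. 1 :: nat) j \<and> (\<forall>l\<in>{1..(\<lambda>_. 1 :: nat) j}.
        references_only PP (SH i j) (props (proc PP j)) ((\<lambda>j _. cmd_guard i b \<sigma> j) j l) \<and>
        fst ` set ((\<lambda>j _. cmd_action i \<sigma> d j) j l) \<subseteq> SH i j)"
      using references_only_guard by (auto simp: I_image[OF that] SH_def cmd_action_def)
  qed
  ultimately have "pairwise_normal_form_wrt PP I"
    unfolding pairwise_normal_form_wrt_def by (fastforce elim: pp_arcs_cases)
  moreover have "I \<subseteq> {1..nprocs PP} \<times> {1..nprocs PP}" "irrefl I" "sym I"
    by (auto simp: I_def irrefl_def sym_def)
  ultimately show ?thesis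
    unfolding pairwise_normal_form_def by blast
qed

section \<open>The bisimulation between \<open>Q\<close> and \<open>PP\<close>\<close>

definition represents :: "('l, nat, nat) gstate \<Rightarrow> ('l, 'x, 'v) gstate \<Rightarrow> bool" where
  "represents h g \<longleftrightarrow> g \<in> global_states Q \<and> h \<in> pp_states \<and> loc h = loc g \<and>
     (\<forall>k\<in>procs. row_sum k (sh h) = enc (sh g))"

lemma decode_represented:
  assumes "represents h g" "i \<in> procs"
  shows "decode i h = g"
  using assms enc_inj by (simp add: decode_def represents_def global_states_def)

text \<open>A guess \<open>\<sigma>\<close> whose guards pass need not equal \<open>h\<close>, but
  agrees with it on everything that \<open>i\<close> sees.\<close>

lemma decode_cong:
  assumes "\<forall>j\<in>procs - {i}. cmd_guard i b \<sigma> j h" "loc h i = loc \<sigma> i"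
    and "h \<in> pp_states" "\<sigma> \<in> pp_states"
  shows "decode i \<sigma> = decode i h" "row_sum i (sh \<sigma>) = row_sum i (sh h)"
proof -
  have "loc \<sigma> = loc h"
  proof
    fix j
    show "loc \<sigma> j = loc h j"
      \<comment> \<open>Outside the processes both sides are \<open>undefined\<close>; for
        \<open>i\<close> itself the source node decides, for any other process the guard.\<close>
      using assms by (cases "j \<in> procs"; cases "j = i")
        (auto simp: cmd_guard_def pp_states_def PiE_iff extensional_def)
  qed
  moreover show "row_sum i (sh \<sigma>) = row_sum i (sh h)"
    using assms(1)
    by (auto simp: row_sum_def cmd_guard_def intro!: arg_cong[where f = "\<lambda>n. n mod N"] sum.cong)
  ultimately show "decode i \<sigma> = decode i h"
    by (simp add: decode_def)
qed

text \<open>Common core of both directions. The offset \<open>d\<close> is specified by the sum of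
  \<open>i\<close> alone, but by the invariant all sums carry the same code, so it is right for each
  of them.\<close>

lemma represents_successor:
  assumes "represents h g" "i \<in> procs" "(loc g i, c, t) \<in> arcs (proc Q i)" "u \<in> effects c g"
    and "enc (apply_update u (sh g)) = (row_sum i (sh h) + d) mod N"
  shows "represents \<lparr>loc = (loc h)(i := t), sh = bump i d (sh h)\<rparr>
           \<lparr>loc = (loc g)(i := t), sh = apply_update u (sh g)\<rparr>"
proof -
  have rep: "g \<in> global_states Q" "h \<in> pp_states" "loc h = loc g"
    "\<And>k. k \<in> procs \<Longrightarrow> row_sum k (sh h) = enc (sh g)"
    using assms(1) by (auto simp: represents_def)
  have succ: "\<lparr>loc = (loc g)(i := t), sh = apply_update u (sh g)\<rparr> \<in> global_states Q"
    using global_states_successor[OF fin rep(1) assms(2-4)] .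
  moreover have "\<lparr>loc = (loc h)(i := t), sh = bump i d (sh h)\<rparr> \<in> pp_states"
    using succ rep(2,3) bump_PiE[OF assms(2)] by (simp add: pp_states_def global_states_def)
  moreover have "row_sum k (bump i d (sh h)) = enc (apply_update u (sh g))" if "k \<in> procs" for k
    using assms(2,5) rep(4) that by (simp add: row_sum_bump)
  ultimately show ?thesis
    using rep(3) by (simp add: represents_def)
qed

text \<open>The arc to take is the one whose guess is \<open>h\<close> itself, so that its guards
  hold trivially.\<close>

lemma represents_forward:
  assumes "represents h g" "(g, i, g') \<in> transitions Q"
  shows "\<exists>h'. (h, i, h') \<in> transitions PP \<and> represents h' g'"
proof -
  from assms(2) obtain c t u where g: "g \<in> global_states Q" and i: "i \<in> procs"
    and arc: "(loc g i, c, t) \<in> arcs (proc Q i)" and u: "u \<in> effects c g"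
    and g': "g' = \<lparr>loc = (loc g)(i := t), sh = apply_update u (sh g)\<rparr>"
    by (rule transitionsE)
  have rep: "h \<in> pp_states" "loc h = loc g" "row_sum i (sh h) = enc (sh g)"
    using assms(1) i by (auto simp: represents_def)
  \<comment> \<open>The difference of the codes modulo \<open>N\<close>; adding
    \<open>N - enc (sh g)\<close> avoids truncated subtraction below zero.\<close>
  define d where "d = (enc (sh g') + (N - enc (sh g))) mod N"
  have "g' \<in> global_states Q"
    unfolding g' using global_states_successor[OF fin g i arc u] .
  then have less: "enc (sh g) < N" "enc (sh g') < N"
    using g by (auto simp: global_states_def intro: enc_less)
  have "(enc (sh g) + d) mod N = (enc (sh g') + N) mod N"
    unfolding d_def mod_add_right_eq using less(1) by (simp add: ac_simps)
  then have d: "enc (apply_update u (sh g)) = (row_sum i (sh h) + d) mod N"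
    using less(2) rep(3) by (simp add: g')
  have "decode i h = g"
    using decode_represented[OF assms(1) i] .
  moreover have "d < N"
    using N_pos by (simp add: d_def)
  ultimately have "(loc h i, cmd i True h d, t) \<in> pp_arcs i"
    unfolding pp_arcs_def using arc u d rep by fastforce
  moreover obtain w where w: "w \<in> effects (cmd i True h d) h"
    by (simp add: effects_cmd[OF i] cmd_guard_def)
  ultimately have "(h, i, \<lparr>loc = (loc h)(i := t), sh = bump i d (sh h)\<rparr>) \<in> transitions PP"
    using transitionsI[of h PP i "cmd i True h d" t w] rep(1) i apply_update_cmd[OF i rep(1) w]
    by (simp add: global_states_PP)
  then show ?thesis
    using represents_successor[OF assms(1) i arc u d] unfolding g' by blast
qed

text \<open>The guess in an enabled arc decodes to \<open>g\<close>, so the effect of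
  \<open>c\<close> that justified the arc is an effect in \<open>g\<close>.\<close>

lemma represents_backward:
  assumes "represents h g" "(h, i, h') \<in> transitions PP"
  shows "\<exists>g'. (g, i, g') \<in> transitions Q \<and> represents h' g'"
proof -
  from assms(2) obtain c' t w where h: "h \<in> pp_states" and i: "i \<in> procs"
    and arc': "(loc h i, c', t) \<in> pp_arcs i" and w: "w \<in> effects c' h"
    and h': "h' = \<lparr>loc = (loc h)(i := t), sh = apply_update w (sh h)\<rparr>"
    by (rule transitionsE) (simp add: global_states_PP)
  have rep: "g \<in> global_states Q" "loc h = loc g"
    using assms(1) by (auto simp: represents_def)
  \<comment> \<open>A disabled arc has a false guard for each partner, and a partner exists; an
    empty \<open>Otimes\<close> would always be enabled.\<close>
  have "c' \<noteq> cmd i False undefined 0"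
  proof
    assume "c' = cmd i False undefined 0"
    then have "\<forall>j\<in>procs - {i}. False"
      using w by (simp add: effects_cmd[OF i] cmd_guard_def split: if_splits)
    then show False
      using writer[OF i, of i] by blast
  qed
  then obtain c \<sigma> d u where arc: "(loc h i, c, t) \<in> arcs (proc Q i)" and \<sigma>: "\<sigma> \<in> pp_states"
    and c': "c' = cmd i True \<sigma> d" and loc: "loc \<sigma> i = loc h i"
    and u: "u \<in> effects c (decode i \<sigma>)"
    and d: "enc (apply_update u (sh (decode i \<sigma>))) = (row_sum i (sh \<sigma>) + d) mod N"
    using arc' unfolding pp_arcs_def by blast
  have guards: "\<forall>j\<in>procs - {i}. cmd_guard i True \<sigma> j h"
    using w unfolding c' effects_cmd[OF i] by (auto split: if_splits)
  have dec: "decode i \<sigma> = g" "row_sum i (sh \<sigma>) = row_sum i (sh h)"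
    using decode_cong[OF guards loc[symmetric] h \<sigma>] decode_represented[OF assms(1) i] by simp_all
  have "h' = \<lparr>loc = (loc h)(i := t), sh = bump i d (sh h)\<rparr>"
    using apply_update_cmd[OF i h w[unfolded c']] by (simp add: h')
  moreover have arc_g: "(loc g i, c, t) \<in> arcs (proc Q i)"
    using arc rep(2) by simp
  ultimately show ?thesis
    using represents_successor[OF assms(1) i arc_g u[unfolded dec] d[unfolded dec]]
      transitionsI[OF rep(1) i arc_g u[unfolded dec]] by blast
qed

lemma strongly_bisimilar_PP: "strongly_bisimilar (gstd Q) (gstd PP)"
proof -
  \<comment> \<open>Restricted to reachable states, which are the states of the two
    diagrams.\<close>
  define B where "B = {(g, h). g \<in> states (gstd Q) \<and> h \<in> states (gstd PP) \<and> represents h g}"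
  have "strong_bisimulation (gstd Q) (gstd PP) B"
    unfolding strong_bisimulation_def
  proof (intro conjI ballI, goal_cases)
    case 1
    then show ?case by (auto simp: B_def)
  next
    case (2 gh)
    obtain g h where gh: "gh = (g, h)"
      by fastforce
    then have B: "g \<in> states (gstd Q)" "h \<in> states (gstd PP)" "represents h g"
      using 2 by (auto simp: B_def)
    have "true_props Q g = true_props PP h"
      using B(3) by (simp add: true_props_def represents_def)
    moreover have "\<exists>h'. (h, i, h') \<in> rel (gstd PP) \<and> (g', h') \<in> B"
      if tr: "(g, i, g') \<in> rel (gstd Q)" for i g'
    proof -
      obtain h' where "(h, i, h') \<in> transitions PP" and rep: "represents h' g'"
        using represents_forward[OF B(3)] tr rel_gstd_iff by blast
      then have "(h, i, h') \<in> rel (gstd PP)"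
        using B(2) by (simp add: rel_gstd_iff)
      then show ?thesis
        using rep rel_gstd_target[OF tr] rel_gstd_target[of h i h'] by (auto simp: B_def)
    qed
    moreover have "\<exists>g'. (g, i, g') \<in> rel (gstd Q) \<and> (g', h') \<in> B"
      if tr: "(h, i, h') \<in> rel (gstd PP)" for i h'
    proof -
      obtain g' where "(g, i, g') \<in> transitions Q" and rep: "represents h' g'"
        using represents_backward[OF B(3)] tr rel_gstd_iff by blast
      then have "(g, i, g') \<in> rel (gstd Q)"
        using B(1) by (simp add: rel_gstd_iff)
      then show ?thesis
        using rep rel_gstd_target[OF tr] rel_gstd_target[of g i g'] by (auto simp: B_def)
    qed
    ultimately show ?case
      by (simp add: gh)
  qed
  moreover have "(g, pp_init g) \<in> B" if "g \<in> init Q" for g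
  proof -
    have "g \<in> global_states Q"
      using fin that by (auto simp: finite_state_program_def)
    then have "represents (pp_init g) g"
      using pp_init_in_pp_states row_sum_pp_init by (simp add: represents_def) (simp add: pp_init_def)
    then show ?thesis
      using that init_subset_states[of Q] init_subset_states[of PP] by (auto simp: B_def)
  qed
  ultimately show ?thesis
    unfolding strongly_bisimilar_def by auto
qed

end

theorem theorem4:
  fixes Q :: "('l, 'x, 'v, 'p) program"
  assumes "finite_state_program Q"
    and "2 \<le> nprocs Q"
  shows "\<exists>PP :: ('l, nat, nat, 'p) program.
           finite_state_program PP \<and>
           nprocs PP = nprocs Q \<and>
           strongly_bisimilar (gstd Q) (gstd PP) \<and>
           pairwise_normal_form PP"
proof -
  let ?W = "\<Pi>\<^sub>E x\<in>vars Q. vals Q x"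
  have "finite ?W"
    using assms(1) by (intro finite_PiE) (auto simp: finite_state_program_def)
  then obtain enc where enc: "bij_betw enc ?W {0..<card ?W}"
    using ex_bij_betw_finite_nat by blast
  \<comment> \<open>\<open>Suc\<close> keeps the modulus positive even if there is no valuation at
    all, that is, if some variable has no possible value.\<close>
  interpret coded_program Q "Suc (card ?W)" enc
  proof
    show "enc f < Suc (card ?W)" if "f \<in> ?W" for f
      using bij_betwE[OF enc] that by fastforce
  qed (use assms enc in \<open>auto simp: bij_betw_def\<close>)
  show ?thesis
    using finite_state_program_PP strongly_bisimilar_PP pairwise_normal_form_PP PP_simps(1) by blast
qed

end
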